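(* Consider the normal sequence model $y_i=\theta^*_i+\varepsilon_i$, $i=1,\dots,n$, where $\varepsilon_1,\dots,\varepsilon_n$ are i.i.d. $N(0,\tau^2/n)$ and the unknown vector $\theta^*$ belongs to $\mathbb{B}_q(R_q)\subset\mathbb{R}^n$ for some $q\in(0,1]$, in the asymptotic regime where $n\to\infty$ and $R_q=R_q(n)>0$ satisfies $\frac{n}{R_qn^{q/2}}=\Omega(n^\kappa)$ for some fixed $\kappa>0$. Then there are constants $0<c'_q\le c_q$ depending only on $q$ (and on $\kappa$) such that, for all sufficiently large $n$, $$c'_q\,R_q\Big(\frac{2\tau^2\log n}{n}\Big)^{1-\frac q2}\;\le\;\min_{\hat\theta}\max_{\theta^*\in\mathbb{B}_q(R_q)}\mathbb{E}\|\hat\theta-\theta^*\|_2^2\;\le\;c_q\,R_q\Big(\frac{2\tau^2\log n}{n}\Big)^{1-\frac q2}.$$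
   Context: $\mathbb{B}_q(R_q)=\{\theta\in\mathbb{R}^n:\sum_{j=1}^n|\theta_j|^q\le R_q\}$. The minimum is the infimum over all measurable estimators $\hat\theta=\hat\theta(y_1,\dots,y_n)\in\mathbb{R}^n$, and $\tau>0$ is fixed.
   Formalization: The lower bound is asserted only at those n with (2τ² log n / n)^{q/2} ≤ R_q(n); without this it fails (e.g. R_q = n^{-5}, where the zero estimator has risk at most R_q^{2/q}). The upper bound is unrestricted. *)

theory Defs
  imports "HOL-Probability.Probability" "HOL-Library.Landau_Symbols"
begin

(* The dimension n varies with the asymptotics, so a vector of R^n is an extensional
   function on {1..n}, and the Borel space R^n is the product of n copies of borel. *)

definition lq_ball :: "nat \<Rightarrow> real \<Rightarrow> real \<Rightarrow> (nat \<Rightarrow> real) set" where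
  "lq_ball n q R = {\<theta> \<in> {1..n} \<rightarrow>\<^sub>E UNIV. (\<Sum>j\<in>{1..n}. \<bar>\<theta> j\<bar> powr q) \<le> R}"

abbreviation borel_vec :: "nat \<Rightarrow> (nat \<Rightarrow> real) measure" where
  "borel_vec n \<equiv> PiM {1..n} (\<lambda>_. borel)"

(* The second argument of normal_density is the standard deviation, so each of the
   independent coordinates has law N(0, \<tau>^2 / n). *)
definition noise_law :: "real \<Rightarrow> nat \<Rightarrow> (nat \<Rightarrow> real) measure" where
  "noise_law \<tau> n = PiM {1..n} (\<lambda>_. density lborel (normal_density 0 (\<tau> / sqrt (real n))))"

definition observation :: "nat \<Rightarrow> (nat \<Rightarrow> real) \<Rightarrow> (nat \<Rightarrow> real) \<Rightarrow> (nat \<Rightarrow> real)" where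
  "observation n \<theta> \<epsilon> = (\<lambda>i\<in>{1..n}. \<theta> i + \<epsilon> i)"

(* Extended-valued, so that estimators with infinite risk are admitted. *)
definition risk :: "real \<Rightarrow> nat \<Rightarrow> ((nat \<Rightarrow> real) \<Rightarrow> (nat \<Rightarrow> real)) \<Rightarrow> (nat \<Rightarrow> real) \<Rightarrow> ennreal" where
  "risk \<tau> n est \<theta> =
     (\<integral>\<^sup>+ \<epsilon>. ennreal ((L2_set (\<lambda>i. est (observation n \<theta> \<epsilon>) i - \<theta> i) {1..n})\<^sup>2) \<partial>noise_law \<tau> n)"

definition minimax_risk :: "real \<Rightarrow> nat \<Rightarrow> (nat \<Rightarrow> real) set \<Rightarrow> ennreal" where
  "minimax_risk \<tau> n \<Theta> = (INF est \<in> borel_vec n \<rightarrow>\<^sub>M borel_vec n. SUP \<theta> \<in> \<Theta>. risk \<tau> n est \<theta>)"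

end

(* Write d = sqrt (2 \<tau>^2 log n / n).

   Upper bound: hard thresholding at 4d loses at most a constant times min(\<theta>_i^2, d^2), hence at most
   |\<theta>_i|^q d^(2-q), in each coordinate, plus the noise in the rare event |\<epsilon>_i| > 2d, which totals
   at most a constant times d^2. If R_q < d^q, the estimator 0 is good enough instead.

   Lower bound: put one spike of height h = a d at a uniform position in each of k = floor(R_q / h^q)
   disjoint blocks of length m = floor(n / k), independently. Within a block let L_j be the likelihood
   ratio of a spike at j against no spike. No estimate is closer than h / sqrt 2 to two of the m
   candidate spikes, so the posterior loss is at least h^2/2 (sum L_j - max L_j), whose mean is at least
   m h^2 / 4 once E L_j^2 = exp(h^2 n / \<tau>^2) = n^(2 a^2) is at most m / 4. The growth condition makes m at
   least a power of n, so that a small enough a depending only on \<kappa> works. *)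
theory Submission
  imports Defs "HOL-Real_Asymp.Real_Asymp"
begin

section \<open>Change of measure for a shifted Gaussian, and a truncated second moment\<close>

section \<open>Gaussian shifts and tails\<close>

abbreviation gauss :: "real \<Rightarrow> real measure" where
  "gauss \<sigma> \<equiv> density lborel (normal_density 0 \<sigma>)"

abbreviation gauss_vec :: "'i set \<Rightarrow> real \<Rightarrow> ('i \<Rightarrow> real) measure" where
  "gauss_vec I \<sigma> \<equiv> PiM I (\<lambda>_. gauss \<sigma>)"

text \<open>The likelihood ratio of the centred Gaussian shifted by \<open>h\<close> against the unshifted one.\<close>
definition shift_lr :: "real \<Rightarrow> real \<Rightarrow> real \<Rightarrow> real" where
  "shift_lr \<sigma> h x = exp (h * x / \<sigma>\<^sup>2 - h\<^sup>2 / (2 * \<sigma>\<^sup>2))"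

lemma shift_lr_nonneg [simp]: "0 \<le> shift_lr \<sigma> h x"
  by (simp add: shift_lr_def)

lemma shift_lr_measurable [measurable]: "shift_lr \<sigma> h \<in> borel_measurable borel"
  unfolding shift_lr_def by measurable

lemma product_prob_space_gauss: "\<sigma> > 0 \<Longrightarrow> product_prob_space (\<lambda>_. gauss \<sigma>)"
  by (rule product_prob_spaceI) (rule prob_space_normal_density)

lemma nn_integral_gauss_vec_component:
  assumes "\<sigma> > 0" "i \<in> I" and [measurable]: "f \<in> borel_measurable borel"
  shows "(\<integral>\<^sup>+\<epsilon>. f (\<epsilon> i) \<partial>gauss_vec I \<sigma>) = (\<integral>\<^sup>+x. f x \<partial>gauss \<sigma>)"
proof -
  interpret product_prob_space "\<lambda>_. gauss \<sigma>" I
    using assms(1) by (rule product_prob_space_gauss)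
  have "(\<integral>\<^sup>+x. f x \<partial>gauss \<sigma>) = (\<integral>\<^sup>+x. f x \<partial>distr (gauss_vec I \<sigma>) (gauss \<sigma>) (\<lambda>\<omega>. \<omega> i))"
    using PiM_component[OF assms(2)] by simp
  also have "\<dots> = (\<integral>\<^sup>+\<epsilon>. f (\<epsilon> i) \<partial>gauss_vec I \<sigma>)"
    using assms(2) by (intro nn_integral_distr) auto
  finally show ?thesis ..
qed

lemma normal_density_shift:
  assumes "\<sigma> > 0"
  shows "normal_density 0 \<sigma> (x - h) = normal_density 0 \<sigma> x * shift_lr \<sigma> h x"
proof -
  have "- (x - h)\<^sup>2 / (2 * \<sigma>\<^sup>2) = - x\<^sup>2 / (2 * \<sigma>\<^sup>2) + (h * x / \<sigma>\<^sup>2 - h\<^sup>2 / (2 * \<sigma>\<^sup>2))"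
    using assms by (simp add: field_simps power2_eq_square)
  then show ?thesis
    unfolding normal_density_def shift_lr_def diff_0_right
    by (simp only: exp_add mult.assoc)
qed

lemma nn_integral_gauss_shift:
  assumes "\<sigma> > 0" and [measurable]: "f \<in> borel_measurable borel"
  shows "(\<integral>\<^sup>+x. f (h + x) \<partial>gauss \<sigma>) = (\<integral>\<^sup>+x. f x * ennreal (shift_lr \<sigma> h x) \<partial>gauss \<sigma>)"
proof -
  have "(\<integral>\<^sup>+x. f (h + x) \<partial>gauss \<sigma>) = (\<integral>\<^sup>+x. ennreal (normal_density 0 \<sigma> x) * f (h + x) \<partial>lborel)"
    by (simp add: nn_integral_density)
  also have "\<dots> = (\<integral>\<^sup>+x. ennreal (normal_density 0 \<sigma> (x - h)) * f x \<partial>lborel)"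
    by (subst nn_integral_real_affine[where c = 1 and t = h
        and f = "\<lambda>x. ennreal (normal_density 0 \<sigma> (x - h)) * f x"]) auto
  also have "\<dots> = (\<integral>\<^sup>+x. ennreal (normal_density 0 \<sigma> x) * (f x * ennreal (shift_lr \<sigma> h x)) \<partial>lborel)"
    by (simp add: normal_density_shift[OF assms(1)] ennreal_mult mult_ac)
  also have "\<dots> = (\<integral>\<^sup>+x. f x * ennreal (shift_lr \<sigma> h x) \<partial>gauss \<sigma>)"
    by (simp add: nn_integral_density)
  finally show ?thesis .
qed

text \<open>Fubini isolates coordinate \<open>j\<close>, where the one-dimensional change of
  variables turns the shift into a density. All spike positions can thus be compared under one and
  the same noise law.\<close>

lemma nn_integral_gauss_vec_shift:
  assumes "\<sigma> > 0" "finite I" "j \<in> I" and F: "F \<in> borel_measurable (PiM I (\<lambda>_. borel))"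
  shows "(\<integral>\<^sup>+\<epsilon>. F (\<epsilon>(j := h + \<epsilon> j)) \<partial>gauss_vec I \<sigma>)
       = (\<integral>\<^sup>+\<epsilon>. F \<epsilon> * ennreal (shift_lr \<sigma> h (\<epsilon> j)) \<partial>gauss_vec I \<sigma>)"
proof -
  interpret product_prob_space "\<lambda>_. gauss \<sigma>" I
    using assms(1) by (rule product_prob_space_gauss)
  define J where "J = I - {j}"
  have I: "I = insert j J" "finite J" "j \<notin> J"
    using assms by (auto simp: J_def)
  have [measurable_cong]: "sets (gauss_vec K \<sigma>) = sets (PiM K (\<lambda>_. borel))" for K :: "'a set"
    by (intro sets_PiM_cong) auto
  have F'[measurable]: "F \<in> borel_measurable (PiM (insert j J) (\<lambda>_. borel))"
    using F I by simp
  have upd: "(\<lambda>y. x(j := y)) \<in> borel \<rightarrow>\<^sub>M PiM (insert j J) (\<lambda>_. borel)"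
    if "x \<in> space (gauss_vec J \<sigma>)" for x :: "'a \<Rightarrow> real"
    using that by (intro measurable_component_update) (auto simp: space_PiM I)
  have [measurable]: "(\<lambda>\<epsilon>. \<epsilon>(j := h + \<epsilon> j)) \<in> PiM (insert j J) (\<lambda>_. borel) \<rightarrow>\<^sub>M PiM (insert j J) (\<lambda>_. borel)"
    unfolding fun_upd_def
  proof (rule measurable_PiM_single')
    fix i assume "i \<in> insert j J"
    then show "(\<lambda>\<epsilon>. if i = j then h + \<epsilon> j else \<epsilon> i) \<in> PiM (insert j J) (\<lambda>_. borel) \<rightarrow>\<^sub>M borel"
      by (cases "i = j") auto
  qed (auto simp: space_PiM PiE_iff extensional_def)
  have "(\<integral>\<^sup>+\<epsilon>. F (\<epsilon>(j := h + \<epsilon> j)) \<partial>gauss_vec I \<sigma>)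
      = (\<integral>\<^sup>+x. (\<integral>\<^sup>+y. F (x(j := h + y)) \<partial>gauss \<sigma>) \<partial>gauss_vec J \<sigma>)"
    unfolding I(1) by (subst product_nn_integral_insert) (use I in auto)
  also have "\<dots> = (\<integral>\<^sup>+x. (\<integral>\<^sup>+y. F (x(j := y)) * ennreal (shift_lr \<sigma> h y) \<partial>gauss \<sigma>) \<partial>gauss_vec J \<sigma>)"
    by (intro nn_integral_cong nn_integral_gauss_shift[OF assms(1)]
        measurable_compose[OF upd F'])
  also have "\<dots> = (\<integral>\<^sup>+\<epsilon>. F \<epsilon> * ennreal (shift_lr \<sigma> h (\<epsilon> j)) \<partial>gauss_vec I \<sigma>)"
    unfolding I(1) by (subst product_nn_integral_insert) (use I in auto)
  finally show ?thesis .
qed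

lemma nn_integral_shift_lr:
  assumes "\<sigma> > 0"
  shows "(\<integral>\<^sup>+x. ennreal (shift_lr \<sigma> h x) \<partial>gauss \<sigma>) = 1"
proof -
  interpret prob_space "gauss \<sigma>"
    using assms by (rule prob_space_normal_density)
  show ?thesis
    using nn_integral_gauss_shift[OF assms, of "\<lambda>_. 1" h] emeasure_space_1 by simp
qed

text \<open>One of the two factors is read as a change of measure, so the other is evaluated at
  \<open>h + x\<close>, where it is a constant multiple of its value at \<open>x\<close>. The result
  is one plus the chi-square divergence of the shifted law from the centred one.\<close>

lemma nn_integral_shift_lr_square:
  assumes "\<sigma> > 0"
  shows "(\<integral>\<^sup>+x. ennreal ((shift_lr \<sigma> h x)\<^sup>2) \<partial>gauss \<sigma>) = ennreal (exp (h\<^sup>2 / \<sigma>\<^sup>2))"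
proof -
  have eq: "shift_lr \<sigma> h (h + x) = exp (h\<^sup>2 / \<sigma>\<^sup>2) * shift_lr \<sigma> h x" for x
    using assms unfolding shift_lr_def exp_add[symmetric]
    by (simp add: field_simps power2_eq_square)
  have "(\<integral>\<^sup>+x. ennreal ((shift_lr \<sigma> h x)\<^sup>2) \<partial>gauss \<sigma>)
      = (\<integral>\<^sup>+x. ennreal (shift_lr \<sigma> h x) * ennreal (shift_lr \<sigma> h x) \<partial>gauss \<sigma>)"
    by (simp add: power2_eq_square ennreal_mult)
  also have "\<dots> = (\<integral>\<^sup>+x. ennreal (shift_lr \<sigma> h (h + x)) \<partial>gauss \<sigma>)"
    by (rule nn_integral_gauss_shift[OF assms, symmetric]) simp
  also have "\<dots> = (\<integral>\<^sup>+x. ennreal (exp (h\<^sup>2 / \<sigma>\<^sup>2)) * ennreal (shift_lr \<sigma> h x) \<partial>gauss \<sigma>)"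
    by (simp add: eq ennreal_mult)
  also have "\<dots> = ennreal (exp (h\<^sup>2 / \<sigma>\<^sup>2))"
    using assms by (simp add: nn_integral_cmult nn_integral_shift_lr)
  finally show ?thesis .
qed

text \<open>Controls the loss of hard thresholding on the event of large noise. Giving up half of
  the exponent keeps the bound free of polynomial factors in \<open>s\<close>.\<close>

lemma nn_integral_gauss_tail:
  assumes "\<sigma> > 0" "s \<ge> 0"
  shows "(\<integral>\<^sup>+x. ennreal (x\<^sup>2 * indicator {x. s < \<bar>x\<bar>} x) \<partial>gauss \<sigma>)
       \<le> ennreal (3 * \<sigma>\<^sup>2 * exp (- s\<^sup>2 / (4 * \<sigma>\<^sup>2)))"
proof -
  define E where "E = exp (- s\<^sup>2 / (4 * \<sigma>\<^sup>2))"
  define \<rho> where "\<rho> = sqrt 2 * \<sigma>"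
  have \<rho>: "\<rho> > 0" "\<rho>\<^sup>2 = 2 * \<sigma>\<^sup>2"
    using assms by (auto simp: \<rho>_def power_mult_distrib)
  \<comment> \<open>Half of the Gaussian exponent pays for the tail; the other half is a Gaussian of twice the variance.\<close>
  have dens: "normal_density 0 \<sigma> x \<le> sqrt 2 * E * normal_density 0 \<rho> x" if "s < \<bar>x\<bar>" for x
  proof -
    have "s\<^sup>2 \<le> x\<^sup>2"
      using that assms by (metis abs_le_square_iff abs_of_nonneg less_imp_le)
    then have "exp (- x\<^sup>2 / (4 * \<sigma>\<^sup>2)) \<le> E"
      using assms by (auto simp: E_def field_simps)
    moreover have "normal_density 0 \<sigma> x
        = sqrt 2 * exp (- x\<^sup>2 / (4 * \<sigma>\<^sup>2)) * normal_density 0 \<rho> x"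
    proof -
      have "- x\<^sup>2 / (2 * \<sigma>\<^sup>2) = - x\<^sup>2 / (4 * \<sigma>\<^sup>2) + - x\<^sup>2 / (4 * \<sigma>\<^sup>2)"
        by (simp add: field_simps)
      then have "exp (- x\<^sup>2 / (2 * \<sigma>\<^sup>2)) = exp (- x\<^sup>2 / (4 * \<sigma>\<^sup>2)) * exp (- x\<^sup>2 / (4 * \<sigma>\<^sup>2))"
        by (simp only: exp_add)
      moreover have "2 * \<rho>\<^sup>2 = 4 * \<sigma>\<^sup>2" "sqrt (2 * pi * \<rho>\<^sup>2) = sqrt 2 * sqrt (2 * pi * \<sigma>\<^sup>2)"
        unfolding \<rho>(2) by (simp_all add: real_sqrt_mult)
      ultimately show ?thesis
        unfolding normal_density_def diff_0_right by simp
    qed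
    ultimately show ?thesis
      by (simp add: mult_right_mono)
  qed
  have int: "has_bochner_integral lborel (\<lambda>x. normal_density 0 \<rho> x * x\<^sup>2) (2 * \<sigma>\<^sup>2)"
    using normal_moment_even[OF \<rho>(1), of 0 1] \<rho> by (simp add: fact_numeral)
  have "(\<integral>\<^sup>+x. ennreal (x\<^sup>2 * indicator {x. s < \<bar>x\<bar>} x) \<partial>gauss \<sigma>)
      = (\<integral>\<^sup>+x. ennreal (normal_density 0 \<sigma> x * (x\<^sup>2 * indicator {x. s < \<bar>x\<bar>} x)) \<partial>lborel)"
    by (simp add: nn_integral_density ennreal_mult)
  also have "\<dots> \<le> (\<integral>\<^sup>+x. ennreal (sqrt 2 * E) * ennreal (normal_density 0 \<rho> x * x\<^sup>2) \<partial>lborel)"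
  proof (rule nn_integral_mono)
    fix x :: real
    have "normal_density 0 \<sigma> x * (x\<^sup>2 * indicator {x. s < \<bar>x\<bar>} x)
        \<le> sqrt 2 * E * (normal_density 0 \<rho> x * x\<^sup>2)"
      using mult_right_mono[OF dens, of x "x\<^sup>2"]
      by (cases "s < \<bar>x\<bar>") (auto simp: mult_ac E_def)
    then show "ennreal (normal_density 0 \<sigma> x * (x\<^sup>2 * indicator {x. s < \<bar>x\<bar>} x))
        \<le> ennreal (sqrt 2 * E) * ennreal (normal_density 0 \<rho> x * x\<^sup>2)"
      by (subst ennreal_mult[symmetric]) (auto simp: E_def intro!: ennreal_leI)
  qed
  also have "\<dots> = ennreal (sqrt 2 * E) * ennreal (2 * \<sigma>\<^sup>2)"
    using int by (subst nn_integral_cmult)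
      (auto simp: has_bochner_integral_iff nn_integral_eq_integral)
  also have "\<dots> = ennreal (sqrt 2 * 2 * (E * \<sigma>\<^sup>2))"
    by (subst ennreal_mult[symmetric]) (auto simp: E_def mult_ac)
  also have "\<dots> \<le> ennreal (3 * (E * \<sigma>\<^sup>2))"
  proof -
    \<comment> \<open>This rounds the constant 2 sqrt 2 up to 3.\<close>
    have "sqrt 2 \<le> 3 / 2"
      by (rule real_le_lsqrt) (auto simp: power2_eq_square)
    then show ?thesis
      by (intro ennreal_leI mult_right_mono) (auto simp: E_def)
  qed
  finally show ?thesis
    by (simp add: E_def mult_ac)
qed

section \<open>The Bayes risk of a single spike, placed uniformly in one block\<close>

section \<open>Locating one spike in a block\<close>

text \<open>The last summand bounds \<open>h\<^sup>2 / 2 * Max L\<close>: AM-GM for one weight, then the sum of squares, which is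
  what can be integrated.\<close>
lemma weighted_spike_loss_ge:
  fixes L a :: "'i \<Rightarrow> real"
  assumes fin: "finite B" and L: "\<And>j. j \<in> B \<Longrightarrow> 0 \<le> L j" and "m > 0"
  shows "h\<^sup>2 / 2 * (\<Sum>j\<in>B. L j)
       \<le> (\<Sum>j\<in>B. (\<Sum>i\<in>B. (a i - (if i = j then h else 0))\<^sup>2) * L j)
         + h\<^sup>2 / 2 * (m / 4 + (\<Sum>j\<in>B. (L j)\<^sup>2) / m)"
proof -
  define D where "D j = (\<Sum>i\<in>B. (a i - (if i = j then h else 0))\<^sup>2)" for j
  have D_nonneg: "0 \<le> D j" for j
    by (auto simp: D_def intro!: sum_nonneg)
  \<comment> \<open>The coordinates \<open>j\<close> and \<open>k\<close> suffice: at each of them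
    one candidate has the value \<open>h\<close> and the other 0, which costs at least
    \<open>h\<^sup>2 / 2\<close> in total.\<close>
  have separated: "h\<^sup>2 \<le> D j + D k" if "j \<in> B" "k \<in> B" "j \<noteq> k" for j k
  proof -
    have two: "(\<Sum>i\<in>{j, k}. (a i - (if i = l then h else 0))\<^sup>2) \<le> D l" for l
      unfolding D_def using that fin by (intro sum_mono2) auto
    have half: "h\<^sup>2 / 2 \<le> (x - h)\<^sup>2 + x\<^sup>2" for x
    proof -
      have "(x - h)\<^sup>2 + x\<^sup>2 - h\<^sup>2 / 2 = 2 * (x - h / 2)\<^sup>2"
        by (simp add: power2_eq_square field_simps)
      then show ?thesis
        using zero_le_power2[of "x - h / 2"] by linarith
    qed
    show ?thesis
      using two[of j] two[of k] half[of "a j"] half[of "a k"] that by simp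
  qed
  have am_gm: "x \<le> m / 4 + x\<^sup>2 / m" for x
  proof -
    have "m / 4 + x\<^sup>2 / m - x = (m / 2 - x)\<^sup>2 / m"
      using \<open>m > 0\<close> by (simp add: power2_eq_square field_simps)
    then show ?thesis
      using \<open>m > 0\<close> zero_le_power2[of "m / 2 - x"]
      by (metis diff_ge_0_iff_ge divide_nonneg_pos)
  qed
  have "h\<^sup>2 / 2 * (\<Sum>j\<in>B. L j) \<le> (\<Sum>j\<in>B. D j * L j) + h\<^sup>2 / 2 * (m / 4 + (\<Sum>j\<in>B. (L j)\<^sup>2) / m)"
  \<comment> \<open>By \<open>separated\<close>, at most one candidate \<open>k\<close> has loss
    below \<open>h\<^sup>2 / 2\<close>. If there is one, its weight is left out of the sum and paid
    for by the summand with \<open>m\<close>.\<close>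
  proof (cases "\<forall>j\<in>B. h\<^sup>2 / 2 \<le> D j")
    case True
    then have "h\<^sup>2 / 2 * (\<Sum>j\<in>B. L j) \<le> (\<Sum>j\<in>B. D j * L j)"
      unfolding sum_distrib_left by (intro sum_mono mult_right_mono L) auto
    moreover have "0 \<le> h\<^sup>2 / 2 * (m / 4 + (\<Sum>j\<in>B. (L j)\<^sup>2) / m)"
      using \<open>m > 0\<close> by (auto intro!: mult_nonneg_nonneg add_nonneg_nonneg divide_nonneg_pos sum_nonneg)
    ultimately show ?thesis by linarith
  next
    case False
    then obtain k where k: "k \<in> B" "D k < h\<^sup>2 / 2"
      by force
    have "h\<^sup>2 / 2 * (\<Sum>j\<in>B - {k}. L j) \<le> (\<Sum>j\<in>B - {k}. D j * L j)"
      unfolding sum_distrib_left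
    proof (intro sum_mono mult_right_mono)
      fix j assume "j \<in> B - {k}"
      then show "h\<^sup>2 / 2 \<le> D j"
        using separated[of j k] k by auto
    qed (auto intro: L)
    also have "\<dots> \<le> (\<Sum>j\<in>B. D j * L j)"
      using fin by (intro sum_mono2) (auto intro!: mult_nonneg_nonneg D_nonneg L)
    finally have 1: "h\<^sup>2 / 2 * (\<Sum>j\<in>B - {k}. L j) \<le> (\<Sum>j\<in>B. D j * L j)" .
    have "(L k)\<^sup>2 \<le> (\<Sum>j\<in>B. (L j)\<^sup>2)"
      using k fin by (intro member_le_sum) auto
    then have "(L k)\<^sup>2 / m \<le> (\<Sum>j\<in>B. (L j)\<^sup>2) / m"
      using \<open>m > 0\<close> by (intro divide_right_mono) auto
    then have "h\<^sup>2 / 2 * L k \<le> h\<^sup>2 / 2 * (m / 4 + (\<Sum>j\<in>B. (L j)\<^sup>2) / m)"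
      using am_gm[of "L k"] by (intro mult_left_mono) auto
    moreover have "(\<Sum>j\<in>B. L j) = L k + (\<Sum>j\<in>B - {k}. L j)"
      using fin k(1) by (rule sum.remove)
    then have "h\<^sup>2 / 2 * (\<Sum>j\<in>B. L j) = h\<^sup>2 / 2 * L k + h\<^sup>2 / 2 * (\<Sum>j\<in>B - {k}. L j)"
      by (simp only: distrib_left)
    ultimately show ?thesis
      using 1 by linarith
  qed
  then show ?thesis
    by (simp add: D_def)
qed

lemma observation_measurable [measurable]:
  "observation n \<theta> \<in> borel_vec n \<rightarrow>\<^sub>M borel_vec n"
  unfolding observation_def by measurable

text \<open>All the integrals are rewritten over the unshifted noise, so that
  \<open>weighted_spike_loss_ge\<close> applies pointwise. The ratios have mean 1, and the bound on
  \<open>h\<close> makes the correction at most half of the main term, which turns the factor 1/2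
  into 1/4. Outside \<open>B\<close> the vector \<open>\<theta>\<close> is arbitrary and may carry
  the spikes of other blocks.\<close>

lemma sum_spike_risk_ge:
  assumes "\<sigma> > 0" and B: "B \<subseteq> {1..n}" "B \<noteq> {}"
    and base: "\<And>i. i \<in> B \<Longrightarrow> \<theta> i = 0"
    and est[measurable]: "est \<in> borel_vec n \<rightarrow>\<^sub>M borel_vec n"
    and h: "exp (h\<^sup>2 / \<sigma>\<^sup>2) \<le> real (card B) / 4"
  shows "ennreal (real (card B) * (h\<^sup>2 / 4))
       \<le> (\<Sum>j\<in>B. \<integral>\<^sup>+\<epsilon>. ennreal (\<Sum>i\<in>B. (est (observation n (\<theta>(j := h)) \<epsilon>) i
            - (if i = j then h else 0))\<^sup>2) \<partial>gauss_vec {1..n} \<sigma>)"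
    (is "_ \<le> ?S")
proof -
  let ?N = "gauss_vec {1..n} \<sigma>"
  let ?L = "\<lambda>j \<epsilon>. shift_lr \<sigma> h (\<epsilon> j)"
  define m where "m = real (card B)"
  have fin: "finite B"
    using B finite_subset by blast
  then have m: "m > 0"
    using B by (simp add: m_def card_gt_0_iff)
  have [measurable_cong]: "sets ?N = sets (borel_vec n)"
    by (intro sets_PiM_cong) auto
  have B_in[measurable]: "j \<in> {1..n}" if "j \<in> B" for j
    using that B by auto
  define G where "G j y = (\<Sum>i\<in>B. (est y i - (if i = j then h else 0))\<^sup>2)" for j y
  have [measurable]: "G j \<in> borel_measurable (borel_vec n)" for j
    unfolding G_def
    by (intro borel_measurable_sum borel_measurable_power borel_measurable_diff
        borel_measurable_const measurable_compose[OF est measurable_component_singleton] B_in)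
  have [measurable]: "(\<lambda>\<epsilon>. ?L j \<epsilon>) \<in> borel_measurable (borel_vec n)" if "j \<in> B" for j
    by (rule measurable_PiM_component_rev[OF B_in[OF that] shift_lr_measurable])
  have F[measurable]: "(\<lambda>\<epsilon>. ennreal (G j (observation n \<theta> \<epsilon>))) \<in> borel_measurable (borel_vec n)" for j
    by measurable
  \<comment> \<open>Since \<open>\<theta> j = 0\<close>, the spike can be moved from the signal into
    the noise, where it becomes a likelihood ratio.\<close>
  have shifted: "observation n (\<theta>(j := h)) \<epsilon> = observation n \<theta> (\<epsilon>(j := h + \<epsilon> j))" if "j \<in> B" for j \<epsilon>
    using base[OF that] by (auto simp: observation_def)
  have "?S = (\<Sum>j\<in>B. \<integral>\<^sup>+\<epsilon>. ennreal (G j (observation n \<theta> (\<epsilon>(j := h + \<epsilon> j)))) \<partial>?N)"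
    by (intro sum.cong refl) (simp add: shifted G_def)
  also have "\<dots> = (\<Sum>j\<in>B. \<integral>\<^sup>+\<epsilon>. ennreal (G j (observation n \<theta> \<epsilon>)) * ennreal (?L j \<epsilon>) \<partial>?N)"
    by (intro sum.cong refl 
        nn_integral_gauss_vec_shift[OF assms(1) finite_atLeastAtMost B_in F])
  also have "\<dots> = (\<integral>\<^sup>+\<epsilon>. (\<Sum>j\<in>B. ennreal (G j (observation n \<theta> \<epsilon>)) * ennreal (?L j \<epsilon>)) \<partial>?N)"
    by (intro nn_integral_sum[symmetric]) measurable
  finally have S: "?S = (\<integral>\<^sup>+\<epsilon>. (\<Sum>j\<in>B. ennreal (G j (observation n \<theta> \<epsilon>)) * ennreal (?L j \<epsilon>)) \<partial>?N)" .
  have G_nonneg: "0 \<le> G j y" for j y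
    by (auto simp: G_def intro!: sum_nonneg)
  interpret product_prob_space "\<lambda>_. gauss \<sigma>" "{1..n}"
    using assms(1) by (rule product_prob_space_gauss)
  have L1: "(\<integral>\<^sup>+\<epsilon>. ennreal (?L j \<epsilon>) \<partial>?N) = 1" if "j \<in> B" for j
    using nn_integral_gauss_vec_component[OF assms(1) B_in[OF that], of "\<lambda>x. ennreal (shift_lr \<sigma> h x)"]
    by (simp add: nn_integral_shift_lr[OF assms(1)])
  have L2: "(\<integral>\<^sup>+\<epsilon>. ennreal ((?L j \<epsilon>)\<^sup>2) \<partial>?N) = ennreal (exp (h\<^sup>2 / \<sigma>\<^sup>2))" if "j \<in> B" for j
    using nn_integral_gauss_vec_component[OF assms(1) B_in[OF that], of "\<lambda>x. ennreal ((shift_lr \<sigma> h x)\<^sup>2)"]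
    by (simp add: nn_integral_shift_lr_square[OF assms(1)])
  have "ennreal (h\<^sup>2 / 2) * ennreal m = (\<integral>\<^sup>+\<epsilon>. ennreal (h\<^sup>2 / 2) * (\<Sum>j\<in>B. ennreal (?L j \<epsilon>)) \<partial>?N)"
    by (simp add: nn_integral_cmult nn_integral_sum L1 m_def ennreal_of_nat_eq_real_of_nat
        del: sum_ennreal One_nat_def)
  also have "\<dots> \<le> (\<integral>\<^sup>+\<epsilon>. (\<Sum>j\<in>B. ennreal (G j (observation n \<theta> \<epsilon>)) * ennreal (?L j \<epsilon>))
      + ennreal (h\<^sup>2 / 2) * (ennreal (m / 4) + ennreal (1 / m) * (\<Sum>j\<in>B. ennreal ((?L j \<epsilon>)\<^sup>2))) \<partial>?N)"
  proof (rule nn_integral_mono)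
    fix \<epsilon>
    have "ennreal (h\<^sup>2 / 2) * (\<Sum>j\<in>B. ennreal (?L j \<epsilon>)) = ennreal (h\<^sup>2 / 2 * (\<Sum>j\<in>B. ?L j \<epsilon>))"
      by (subst ennreal_mult) (simp_all add: sum_nonneg)
    also have "\<dots> \<le> ennreal ((\<Sum>j\<in>B. G j (observation n \<theta> \<epsilon>) * ?L j \<epsilon>)
        + h\<^sup>2 / 2 * (m / 4 + (\<Sum>j\<in>B. (?L j \<epsilon>)\<^sup>2) / m))"
      unfolding G_def by (intro ennreal_leI weighted_spike_loss_ge fin m) simp
    also have "\<dots> = (\<Sum>j\<in>B. ennreal (G j (observation n \<theta> \<epsilon>)) * ennreal (?L j \<epsilon>))
      + ennreal (h\<^sup>2 / 2) * (ennreal (m / 4) + ennreal (1 / m) * (\<Sum>j\<in>B. ennreal ((?L j \<epsilon>)\<^sup>2)))"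
      using m G_nonneg
      by (simp add: ennreal_mult[symmetric] sum_nonneg ennreal_plus[symmetric] del: ennreal_plus)
    finally show "ennreal (h\<^sup>2 / 2) * (\<Sum>j\<in>B. ennreal (?L j \<epsilon>)) \<le> \<dots>" .
  qed
  also have "\<dots> = ?S + ennreal (h\<^sup>2 / 2) * (ennreal (m / 4) + ennreal (1 / m) * (\<Sum>j\<in>B. ennreal (exp (h\<^sup>2 / \<sigma>\<^sup>2))))"
    unfolding S
    by (simp add: nn_integral_add nn_integral_cmult nn_integral_sum L2 emeasure_space_1
        del: sum_ennreal One_nat_def)
  also have "\<dots> = ?S + ennreal (h\<^sup>2 / 2 * (m / 4 + exp (h\<^sup>2 / \<sigma>\<^sup>2)))"
    using m by (simp add: ennreal_mult[symmetric] ennreal_plus[symmetric] sum_nonneg m_def[symmetric]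
        ennreal_of_nat_eq_real_of_nat del: ennreal_plus)
  also have "\<dots> \<le> ?S + ennreal (h\<^sup>2 / 2 * (m / 2))"
    using h m by (intro add_left_mono ennreal_leI mult_left_mono) (auto simp: m_def)
  finally have "ennreal (h\<^sup>2 / 2 * m) \<le> ?S + ennreal (h\<^sup>2 / 2 * (m / 2))"
    using m by (subst ennreal_mult) simp_all
  \<comment> \<open>The correction has been kept as a summand and is cancelled only at the end: it
    is finite, while \<open>?S\<close> may be infinite.\<close>
  moreover have "ennreal (h\<^sup>2 / 2 * m) = ennreal (m * (h\<^sup>2 / 4)) + ennreal (h\<^sup>2 / 2 * (m / 2))"
    using m by (simp add: ennreal_plus[symmetric] algebra_simps del: ennreal_plus)
  ultimately show ?thesis
    by (simp add: m_def add.commute[of _ "ennreal (h\<^sup>2 / 2 * (real (card B) / 2))"]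
        ennreal_add_left_cancel_le)
qed

section \<open>A product of uniform priors, one for each block\<close>

section \<open>One spike in each of many blocks\<close>

text \<open>Redrawing one coordinate of a uniformly chosen function leaves it uniform. In this way a
  bound for block \<open>b\<close> with the other spikes fixed is averaged over all
  configurations.\<close>

lemma sum_PiE_update:
  assumes "b \<in> A"
  shows "(\<Sum>J\<in>A \<rightarrow>\<^sub>E S. \<Sum>s\<in>S. f (J(b := s))) = of_nat (card S) * (\<Sum>J\<in>A \<rightarrow>\<^sub>E S. f J :: 'c :: comm_semiring_1)"
proof -
  \<comment> \<open>Swapping \<open>J b\<close> with \<open>s\<close> is an involution on the pairs \<open>(J, s)\<close>.\<close>
  have "(\<Sum>J\<in>A \<rightarrow>\<^sub>E S. \<Sum>s\<in>S. f (J(b := s))) = (\<Sum>(J, s)\<in>(A \<rightarrow>\<^sub>E S) \<times> S. f (J(b := s)))"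
    by (rule sum.cartesian_product)
  also have "\<dots> = (\<Sum>(J, s)\<in>(A \<rightarrow>\<^sub>E S) \<times> S. f J)"
    using assms
    by (intro sum.reindex_bij_witness[where i = "\<lambda>(J, s). (J(b := s), J b)"
          and j = "\<lambda>(J, s). (J(b := s), J b)"])
      (auto simp: PiE_iff extensional_def)
  also have "\<dots> = of_nat (card S) * (\<Sum>J\<in>A \<rightarrow>\<^sub>E S. f J)"
    by (simp add: sum.cartesian_product[symmetric] sum_distrib_left)
  finally show ?thesis .
qed

text \<open>Coordinates are numbered from 1, hence the \<open>+ 1\<close>: block number and position
  of \<open>i\<close> are the quotient and remainder of \<open>i - 1\<close> by
  \<open>m\<close>.\<close>

definition block :: "nat \<Rightarrow> nat \<Rightarrow> nat set" where
  "block m b = (\<lambda>s. b * m + s + 1) ` {..<m}"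

lemma mem_block_iff: "i \<in> block m b \<longleftrightarrow> 0 < m \<and> 0 < i \<and> (i - 1) div m = b"
proof
  assume R: "0 < m \<and> 0 < i \<and> (i - 1) div m = b"
  then have "i = b * m + (i - 1) mod m + 1"
    using div_mult_mod_eq[of "i - 1" m] by simp
  moreover have "(i - 1) mod m \<in> {..<m}"
    using R by simp
  ultimately show "i \<in> block m b"
    unfolding block_def by (rule image_eqI)
qed (auto simp: block_def)

lemma card_block [simp]: "card (block m b) = m"
  by (auto simp: block_def card_image inj_on_def)

lemma sum_block: "sum f (block m b) = (\<Sum>s<m. f (b * m + s + 1))"
  unfolding block_def by (subst sum.reindex) (auto simp: inj_on_def)

lemma finite_block [simp]: "finite (block m b)"
  by (simp add: block_def)

lemma block_subset: "b < k \<Longrightarrow> k * m \<le> n \<Longrightarrow> block m b \<subseteq> {1..n}"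
proof
  fix i assume b: "b < k" "k * m \<le> n" and "i \<in> block m b"
  then obtain s where "s < m" "i = b * m + s + 1"
    by (auto simp: block_def)
  moreover have "(b + 1) * m \<le> k * m"
    using b by (intro mult_right_mono) auto
  ultimately show "i \<in> {1..n}"
    using b by simp
qed

text \<open>\<open>J b\<close> is a position within block \<open>b\<close>, counted from 0. For
  positive \<open>m\<close>, the test on the quotient sets the leftover coordinates after the last
  block to 0. The restriction makes the vector extensional, as \<open>lq_ball\<close>
  requires.\<close>

definition spikes :: "nat \<Rightarrow> nat \<Rightarrow> nat \<Rightarrow> real \<Rightarrow> (nat \<Rightarrow> nat) \<Rightarrow> nat \<Rightarrow> real" where
  "spikes n m k h J = (\<lambda>i\<in>{1..n}.
     if (i - 1) div m < k \<and> (i - 1) mod m = J ((i - 1) div m) then h else 0)"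

text \<open>Block \<open>b\<close> has no nonzero coordinate other than
  \<open>b * m + J b + 1\<close>, so the sum has at most \<open>k\<close> nonzero terms.\<close>

lemma spikes_in_lq_ball:
  assumes "0 < h" "0 < q" "real k * h powr q \<le> R"
  shows "spikes n m k h J \<in> lq_ball n q R"
proof -
  define P where "P i \<longleftrightarrow> (i - 1) div m < k \<and> (i - 1) mod m = J ((i - 1) div m)" for i
  have "{i \<in> {1..n}. P i} \<subseteq> (\<lambda>b. b * m + J b + 1) ` {..<k}"
  proof
    fix i assume i: "i \<in> {i \<in> {1..n}. P i}"
    then have "i = (i - 1) div m * m + J ((i - 1) div m) + 1"
      using div_mult_mod_eq[of "i - 1" m] by (auto simp: P_def)
    then show "i \<in> (\<lambda>b. b * m + J b + 1) ` {..<k}"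
      using i by (auto simp: P_def)
  qed
  then have card: "card {i \<in> {1..n}. P i} \<le> k"
    using surj_card_le[of "{..<k}"] by simp
  have "(\<Sum>i\<in>{1..n}. \<bar>spikes n m k h J i\<bar> powr q) = (\<Sum>i\<in>{1..n}. if P i then h powr q else 0)"
    using assms by (intro sum.cong) (auto simp: spikes_def P_def)
  also have "\<dots> = real (card {i \<in> {1..n}. P i}) * h powr q"
    by (simp add: sum.If_cases Int_def)
  also have "\<dots> \<le> real k * h powr q"
    using card by (intro mult_right_mono) auto
  finally show ?thesis
    using assms by (auto simp: lq_ball_def spikes_def)
qed

lemma spikes_update_block:
  assumes "s < m" "b < k" "i \<in> {1..n}" "i \<in> block m b"
  shows "spikes n m k h (J(b := s)) i = (if i = b * m + s + 1 then h else 0)"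
proof -
  obtain t where "t < m" "i = b * m + t + 1"
    using assms by (auto simp: block_def)
  then have "(i - 1) div m = b" "(i - 1) mod m = t"
    by simp_all
  then show ?thesis
    using assms(2,3) \<open>i = b * m + t + 1\<close> by (simp add: spikes_def)
qed

lemma spikes_update_outside:
  assumes "i \<notin> block m b" "0 < m"
  shows "spikes n m k h (J(b := s)) i = spikes n m k h J i"
proof (cases "i \<in> {1..n}")
  case True
  then have "(i - 1) div m \<noteq> b"
    using assms by (simp add: mem_block_iff)
  then show ?thesis
    by (simp add: spikes_def)
next
  case False
  then show ?thesis
    by (simp only: spikes_def restrict_def if_False)
qed

lemma risk_eq:
  "risk \<tau> n est \<theta> = (\<integral>\<^sup>+\<epsilon>. ennreal (\<Sum>i\<in>{1..n}. (est (observation n \<theta> \<epsilon>) i - \<theta> i)\<^sup>2)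
     \<partial>gauss_vec {1..n} (\<tau> / sqrt (real n)))"
  by (simp add: risk_def noise_law_def L2_set_def sum_nonneg)

text \<open>The supremum is at least the average over all configurations \<open>J\<close>. The loss
  splits into block losses \<open>A b J\<close>, and with the other blocks held fixed
  \<open>sum_spike_risk_ge\<close> bounds the average of \<open>A b J\<close> over the position in
  block \<open>b\<close>. Sums are multiplied by the number of configurations instead of being
  divided by it.\<close>

lemma SUP_risk_ge_spikes:
  assumes "0 < \<tau>" "0 < n" "0 < h" "0 < q" "0 < m" "k * m \<le> n"
    and R: "real k * h powr q \<le> R"
    and h: "exp (h\<^sup>2 / (\<tau> / sqrt (real n))\<^sup>2) \<le> real m / 4"
    and est[measurable]: "est \<in> borel_vec n \<rightarrow>\<^sub>M borel_vec n"
  shows "ennreal (real k * (h\<^sup>2 / 4)) \<le> (SUP \<theta>\<in>lq_ball n q R. risk \<tau> n est \<theta>)"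
    (is "_ \<le> ?sup")
proof -
  define \<sigma> where "\<sigma> = \<tau> / sqrt (real n)"
  define N where "N = gauss_vec {1..n} \<sigma>"
  have "\<sigma> > 0"
    using assms by (simp add: \<sigma>_def)
  have [measurable_cong]: "sets N = sets (borel_vec n)"
    unfolding N_def by (intro sets_PiM_cong) auto
  let ?\<theta> = "spikes n m k h"
  define A where "A b J = (\<integral>\<^sup>+\<epsilon>. ennreal (\<Sum>i\<in>block m b.
      (est (observation n (?\<theta> J) \<epsilon>) i - ?\<theta> J i)\<^sup>2) \<partial>N)" for b J
  define P where "P = {..<k} \<rightarrow>\<^sub>E {..<m}"
  define K where "K = real (card P)"
  have P: "finite P" "P \<noteq> {}"
    using \<open>0 < m\<close> by (auto simp: P_def finite_PiE PiE_eq_empty_iff)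
  then have K: "0 < K"
    by (simp add: K_def card_gt_0_iff)
  have block_sub: "block m b \<subseteq> {1..n}" if "b < k" for b
    using that assms block_subset by blast
  have risk_ge: "(\<Sum>b<k. A b J) \<le> risk \<tau> n est (?\<theta> J)" for J
  proof -
    define e where "e \<epsilon> i = (est (observation n (?\<theta> J) \<epsilon>) i - ?\<theta> J i)\<^sup>2" for \<epsilon> i
    have e[measurable]: "(\<lambda>\<epsilon>. e \<epsilon> i) \<in> borel_measurable (borel_vec n)" if "i \<in> {1..n}" for i
      using that unfolding e_def by measurable
    have "(\<Sum>b<k. A b J) = (\<integral>\<^sup>+\<epsilon>. (\<Sum>b<k. ennreal (\<Sum>i\<in>block m b. e \<epsilon> i)) \<partial>N)"
      unfolding A_def e_def[symmetric]
    proof (rule nn_integral_sum[symmetric])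
      fix b assume "b \<in> {..<k}"
      then have [measurable]: "(\<lambda>\<epsilon>. \<Sum>i\<in>block m b. e \<epsilon> i) \<in> borel_measurable (borel_vec n)"
        using block_sub by (intro borel_measurable_sum e) blast
      show "(\<lambda>\<epsilon>. ennreal (\<Sum>i\<in>block m b. e \<epsilon> i)) \<in> borel_measurable N"
        by measurable
    qed
    also have "\<dots> \<le> (\<integral>\<^sup>+\<epsilon>. ennreal (\<Sum>i\<in>{1..n}. e \<epsilon> i) \<partial>N)"
    proof (rule nn_integral_mono)
      fix \<epsilon>
      have "(\<Sum>b<k. ennreal (\<Sum>i\<in>block m b. e \<epsilon> i)) = ennreal (\<Sum>b<k. \<Sum>i\<in>block m b. e \<epsilon> i)"
        by (simp add: e_def sum_nonneg)
      also have "(\<Sum>b<k. \<Sum>i\<in>block m b. e \<epsilon> i) = (\<Sum>i\<in>(\<Union>b<k. block m b). e \<epsilon> i)"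
        by (rule sum.UNION_disjoint[symmetric]) (auto simp: mem_block_iff)
      also have "\<dots> \<le> (\<Sum>i\<in>{1..n}. e \<epsilon> i)"
        using block_sub by (intro sum_mono2) (auto simp: e_def)
      finally show "(\<Sum>b<k. ennreal (\<Sum>i\<in>block m b. e \<epsilon> i)) \<le> ennreal (\<Sum>i\<in>{1..n}. e \<epsilon> i)"
        by (simp add: ennreal_leI)
    qed
    finally show ?thesis
      by (simp add: risk_eq N_def e_def \<sigma>_def)
  qed
  have inner: "ennreal (real m * (h\<^sup>2 / 4)) \<le> (\<Sum>s<m. A b (J(b := s)))" if "b < k" for b J
  proof -
    let ?B = "block m b"
    \<comment> \<open>Block \<open>b\<close> is cleared and the spikes of all other blocks stay:
      this is the vector to which \<open>sum_spike_risk_ge\<close> adds its spike.\<close>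
    define base where "base = (\<lambda>i. if i \<in> ?B then 0 else ?\<theta> J i)"
    have spike: "?\<theta> (J(b := s)) = base(b * m + s + 1 := h)" if s: "s < m" for s
    proof
      fix i show "?\<theta> (J(b := s)) i = (base(b * m + s + 1 := h)) i"
      proof (cases "i \<in> ?B")
        case True
        then show ?thesis
          using spikes_update_block[OF s \<open>b < k\<close> _ True] block_sub[OF \<open>b < k\<close>] by (auto simp: base_def)
      next
        case False
        moreover have "b * m + s + 1 \<in> ?B"
          using s by (auto simp: block_def)
        ultimately show ?thesis
          using spikes_update_outside[OF False \<open>0 < m\<close>] by (auto simp: base_def)
      qed
    qed
    have "ennreal (real (card ?B) * (h\<^sup>2 / 4))
       \<le> (\<Sum>j\<in>?B. \<integral>\<^sup>+\<epsilon>. ennreal (\<Sum>i\<in>?B. (est (observation n (base(j := h)) \<epsilon>) i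
            - (if i = j then h else 0))\<^sup>2) \<partial>gauss_vec {1..n} \<sigma>)"
      using \<open>0 < m\<close> h by (intro sum_spike_risk_ge \<open>\<sigma> > 0\<close> block_sub[OF that] est)
        (auto simp: base_def \<sigma>_def dest: arg_cong[where f = card])
    also have "\<dots> = (\<Sum>s<m. A b (J(b := s)))"
      unfolding A_def N_def sum_block[of "\<lambda>j. nn_integral _ (_ j)"]
    proof (intro sum.cong refl nn_integral_cong arg_cong[where f = ennreal])
      fix s \<epsilon> i assume "s \<in> {..<m}" "i \<in> ?B"
      then show "(est (observation n (base(b * m + s + 1 := h)) \<epsilon>) i
          - (if i = b * m + s + 1 then h else 0))\<^sup>2
        = (est (observation n (?\<theta> (J(b := s))) \<epsilon>) i - ?\<theta> (J(b := s)) i)\<^sup>2"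
        by (auto simp: spike base_def)
    qed
    finally show ?thesis by simp
  qed
  \<comment> \<open>Summing \<open>inner\<close> over all \<open>J\<close> counts every
    configuration \<open>m\<close> times, and this factor cancels the \<open>m\<close> on the left
    of \<open>inner\<close>.\<close>
  have avg: "ennreal (K * (h\<^sup>2 / 4)) \<le> (\<Sum>J\<in>P. A b J)" if "b < k" for b
  proof -
    have "ennreal (real m) * ennreal (K * (h\<^sup>2 / 4)) = (\<Sum>J\<in>P. ennreal (real m * (h\<^sup>2 / 4)))"
      by (simp add: K_def ennreal_of_nat_eq_real_of_nat ennreal_mult[symmetric] mult_ac)
    also have "\<dots> \<le> (\<Sum>J\<in>P. \<Sum>s<m. A b (J(b := s)))"
      by (intro sum_mono inner that)
    also have "\<dots> = ennreal (real m) * (\<Sum>J\<in>P. A b J)"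
      unfolding P_def using that
      by (subst sum_PiE_update) (auto simp: ennreal_of_nat_eq_real_of_nat)
    finally show ?thesis
      using \<open>0 < m\<close> by (subst (asm) ennreal_mult_le_mult_iff) auto
  qed
  have "ennreal K * ennreal (real k * (h\<^sup>2 / 4)) = (\<Sum>b<k. ennreal (K * (h\<^sup>2 / 4)))"
    using K by (simp add: ennreal_of_nat_eq_real_of_nat ennreal_mult[symmetric] mult_ac)
  also have "\<dots> \<le> (\<Sum>b<k. \<Sum>J\<in>P. A b J)"
    by (intro sum_mono avg) simp
  also have "\<dots> = (\<Sum>J\<in>P. \<Sum>b<k. A b J)"
    by (rule sum.swap)
  also have "\<dots> \<le> (\<Sum>J\<in>P. ?sup)"
    by (intro sum_mono order_trans[OF risk_ge] SUP_upper spikes_in_lq_ball assms)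
  also have "\<dots> = ennreal K * ?sup"
    by (simp add: K_def ennreal_of_nat_eq_real_of_nat)
  finally show ?thesis
    using K by (subst (asm) ennreal_mult_le_mult_iff) auto
qed

section \<open>Upper bound: hard thresholding on large balls, zero on small ones\<close>

section \<open>Thresholding estimators\<close>

text \<open>If |e| > T/2, the error is |e| when the observation is kept, and |\<theta>| \<le> T +
  |e| < 3|e| when it is killed. If |e| \<le> T/2, a kept observation forces |\<theta>| > T/2, so the
  error |e| is at most both |\<theta>| and T/2; a killed one has error |\<theta>| \<le> 3T/2. The
  constants are the squares of 3 and 3/2.\<close>

lemma hard_threshold_error:
  fixes \<theta> e T :: real
  assumes "T > 0"
  shows "((if T < \<bar>\<theta> + e\<bar> then \<theta> + e else 0) - \<theta>)\<^sup>2
       \<le> 9 / 4 * min (\<theta>\<^sup>2) (T\<^sup>2) + 9 * (e\<^sup>2 * indicator {x. T / 2 < \<bar>x\<bar>} e)"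
proof (cases "T / 2 < \<bar>e\<bar>")
  case True
  have "((if T < \<bar>\<theta> + e\<bar> then \<theta> + e else 0) - \<theta>)\<^sup>2 \<le> (3 * e)\<^sup>2"
    using True by (intro iffD1[OF abs_le_square_iff]) auto
  also have "\<dots> = 9 * (e\<^sup>2 * indicator {x. T / 2 < \<bar>x\<bar>} e)"
    using True by (simp add: power_mult_distrib)
  also have "\<dots> \<le> 9 / 4 * min (\<theta>\<^sup>2) (T\<^sup>2) + \<dots>"
    by simp
  finally show ?thesis .
next
  case False
  have "((if T < \<bar>\<theta> + e\<bar> then \<theta> + e else 0) - \<theta>)\<^sup>2 \<le> (3 / 2 * \<theta>)\<^sup>2"
    using False by (intro iffD1[OF abs_le_square_iff]) auto
  moreover have "((if T < \<bar>\<theta> + e\<bar> then \<theta> + e else 0) - \<theta>)\<^sup>2 \<le> (3 / 2 * T)\<^sup>2"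
    using False assms by (intro iffD1[OF abs_le_square_iff]) auto
  ultimately show ?thesis
    using False by (simp add: power_mult_distrib power2_eq_square min_def split: if_splits)
qed

text \<open>Interpolation: the smaller of the two squares is split into powers \<open>q\<close> and
  \<open>2 - q\<close>, and the base of one factor is enlarged to the other number.\<close>

lemma min_square_le_powr:
  fixes \<theta> T q :: real
  assumes "T > 0" "0 \<le> q" "q \<le> 2"
  shows "min (\<theta>\<^sup>2) (T\<^sup>2) \<le> \<bar>\<theta>\<bar> powr q * T powr (2 - q)"
proof (cases "\<theta> = 0")
  case False
  have split: "x\<^sup>2 = x powr q * x powr (2 - q)" if "x > 0" for x :: real
    using that by (simp add: powr_add[symmetric])
  show ?thesis
  proof (cases "\<bar>\<theta>\<bar> \<le> T")
    case True
    have "\<theta>\<^sup>2 = \<bar>\<theta>\<bar> powr q * \<bar>\<theta>\<bar> powr (2 - q)"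
      using split[of "\<bar>\<theta>\<bar>"] False by simp
    also have "\<dots> \<le> \<bar>\<theta>\<bar> powr q * T powr (2 - q)"
      using True assms by (intro mult_left_mono powr_mono2) auto
    finally show ?thesis by simp
  next
    case False
    have "T\<^sup>2 \<le> \<bar>\<theta>\<bar> powr q * T powr (2 - q)"
      using False assms unfolding split[OF assms(1)]
      by (intro mult_right_mono powr_mono2) auto
    then show ?thesis by simp
  qed
qed simp

definition hard_threshold :: "nat \<Rightarrow> real \<Rightarrow> (nat \<Rightarrow> real) \<Rightarrow> nat \<Rightarrow> real" where
  "hard_threshold n T y = (\<lambda>i\<in>{1..n}. if T < \<bar>y i\<bar> then y i else 0)"

lemma hard_threshold_measurable [measurable]:
  "hard_threshold n T \<in> borel_vec n \<rightarrow>\<^sub>M borel_vec n"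
  unfolding hard_threshold_def by measurable

text \<open>The first term sums the minima in \<open>hard_threshold_error\<close> over the ball. The
  second is the noise on the event of large deviations, with 27 = 9 * 3 from that lemma and from
  \<open>nn_integral_gauss_tail\<close> at \<open>s = T / 2\<close>.\<close>

lemma risk_hard_threshold_le:
  assumes "0 < \<tau>" "0 < n" "0 < T" "0 < q" "q \<le> 2" and \<theta>: "\<theta> \<in> lq_ball n q R"
  defines "\<sigma> \<equiv> \<tau> / sqrt (real n)"
  shows "risk \<tau> n (hard_threshold n T) \<theta>
       \<le> ennreal (9 / 4 * (R * T powr (2 - q)) + real n * (27 * \<sigma>\<^sup>2 * exp (- (T / 2)\<^sup>2 / (4 * \<sigma>\<^sup>2))))"
proof -
  have "\<sigma> > 0"
    using assms by (simp add: \<sigma>_def)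
  define W where "W = R * T powr (2 - q)"
  define t where "t x = x\<^sup>2 * indicator {x. T / 2 < \<bar>x\<bar>} x" for x :: real
  have [measurable]: "t \<in> borel_measurable borel"
    unfolding t_def by measurable
  have t_nonneg: "0 \<le> t x" for x
    by (simp add: t_def)
  define N where "N = gauss_vec {1..n} \<sigma>"
  have [measurable_cong]: "sets N = sets (borel_vec n)"
    unfolding N_def by (intro sets_PiM_cong) auto
  interpret product_prob_space "\<lambda>_. gauss \<sigma>" "{1..n}"
    using \<open>\<sigma> > 0\<close> by (rule product_prob_space_gauss)
  have space_N: "emeasure N (space N) = 1"
    unfolding N_def by (rule emeasure_space_1)
  have sum_\<theta>: "(\<Sum>i\<in>{1..n}. \<bar>\<theta> i\<bar> powr q) \<le> R"
    using \<theta> by (simp add: lq_ball_def)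
  then have "0 \<le> R"
    by (rule order_trans[rotated]) (auto intro: sum_nonneg)
  then have W: "0 \<le> W"
    by (simp add: W_def)
  have min_sum: "(\<Sum>i\<in>{1..n}. min ((\<theta> i)\<^sup>2) (T\<^sup>2)) \<le> W"
  proof -
    have "(\<Sum>i\<in>{1..n}. min ((\<theta> i)\<^sup>2) (T\<^sup>2)) \<le> (\<Sum>i\<in>{1..n}. \<bar>\<theta> i\<bar> powr q * T powr (2 - q))"
      using assms by (intro sum_mono min_square_le_powr) auto
    also have "\<dots> \<le> W"
      unfolding sum_distrib_right[symmetric] W_def
      using sum_\<theta> by (intro mult_right_mono) auto
    finally show ?thesis .
  qed
  have tail: "(\<integral>\<^sup>+\<epsilon>. ennreal (t (\<epsilon> i)) \<partial>N) \<le> ennreal (3 * \<sigma>\<^sup>2 * exp (- (T / 2)\<^sup>2 / (4 * \<sigma>\<^sup>2)))"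
    if "i \<in> {1..n}" for i
  proof -
    have "(\<integral>\<^sup>+\<epsilon>. ennreal (t (\<epsilon> i)) \<partial>N) = (\<integral>\<^sup>+x. ennreal (t x) \<partial>gauss \<sigma>)"
      unfolding N_def using \<open>\<sigma> > 0\<close> that by (intro nn_integral_gauss_vec_component) auto
    also have "\<dots> \<le> ennreal (3 * \<sigma>\<^sup>2 * exp (- (T / 2)\<^sup>2 / (4 * \<sigma>\<^sup>2)))"
      unfolding t_def using \<open>\<sigma> > 0\<close> \<open>0 < T\<close> by (intro nn_integral_gauss_tail) auto
    finally show ?thesis .
  qed
  have t_meas: "(\<lambda>\<epsilon>. ennreal (t (\<epsilon> i))) \<in> borel_measurable N" if "i \<in> {1..n}" for i
    using that by measurable
  have "risk \<tau> n (hard_threshold n T) \<theta>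
      = (\<integral>\<^sup>+\<epsilon>. ennreal (\<Sum>i\<in>{1..n}. (hard_threshold n T (observation n \<theta> \<epsilon>) i - \<theta> i)\<^sup>2) \<partial>N)"
    by (simp add: risk_eq N_def \<sigma>_def)
  also have "\<dots> \<le> (\<integral>\<^sup>+\<epsilon>. ennreal (9 / 4 * W) + (\<Sum>i\<in>{1..n}. 9 * ennreal (t (\<epsilon> i))) \<partial>N)"
  proof (rule nn_integral_mono)
    fix \<epsilon>
    have "(\<Sum>i\<in>{1..n}. (hard_threshold n T (observation n \<theta> \<epsilon>) i - \<theta> i)\<^sup>2)
        \<le> (\<Sum>i\<in>{1..n}. 9 / 4 * min ((\<theta> i)\<^sup>2) (T\<^sup>2) + 9 * t (\<epsilon> i))"
    proof (rule sum_mono)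
      fix i assume "i \<in> {1..n}"
      then have "hard_threshold n T (observation n \<theta> \<epsilon>) i
          = (if T < \<bar>\<theta> i + \<epsilon> i\<bar> then \<theta> i + \<epsilon> i else 0)"
        by (simp add: hard_threshold_def observation_def)
      then show "(hard_threshold n T (observation n \<theta> \<epsilon>) i - \<theta> i)\<^sup>2
          \<le> 9 / 4 * min ((\<theta> i)\<^sup>2) (T\<^sup>2) + 9 * t (\<epsilon> i)"
        unfolding t_def by (simp only: hard_threshold_error[OF \<open>0 < T\<close>])
    qed
    also have "\<dots> \<le> 9 / 4 * W + (\<Sum>i\<in>{1..n}. 9 * t (\<epsilon> i))"
      unfolding sum.distrib sum_distrib_left[symmetric]
      using min_sum by (intro add_right_mono mult_left_mono) auto
    finally have "ennreal (\<Sum>i\<in>{1..n}. (hard_threshold n T (observation n \<theta> \<epsilon>) i - \<theta> i)\<^sup>2)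
        \<le> ennreal (9 / 4 * W + (\<Sum>i\<in>{1..n}. 9 * t (\<epsilon> i)))"
      by (rule ennreal_leI)
    also have "\<dots> = ennreal (9 / 4 * W) + (\<Sum>i\<in>{1..n}. ennreal (9 * t (\<epsilon> i)))"
      using W t_nonneg by (subst ennreal_plus) (auto simp: sum_nonneg)
    finally show "ennreal (\<Sum>i\<in>{1..n}. (hard_threshold n T (observation n \<theta> \<epsilon>) i - \<theta> i)\<^sup>2)
        \<le> ennreal (9 / 4 * W) + (\<Sum>i\<in>{1..n}. 9 * ennreal (t (\<epsilon> i)))"
      using t_nonneg by (simp add: ennreal_mult)
  qed
  also have "\<dots> = ennreal (9 / 4 * W) + (\<Sum>i\<in>{1..n}. 9 * (\<integral>\<^sup>+\<epsilon>. ennreal (t (\<epsilon> i)) \<partial>N))"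
    using t_meas
    by (simp add: nn_integral_add nn_integral_sum nn_integral_cmult space_N
        del: One_nat_def sum_ennreal)
  also have "\<dots> \<le> ennreal (9 / 4 * W)
      + (\<Sum>i\<in>{1..n}. 9 * ennreal (3 * \<sigma>\<^sup>2 * exp (- (T / 2)\<^sup>2 / (4 * \<sigma>\<^sup>2))))"
    by (intro add_left_mono sum_mono mult_left_mono tail) auto
  also have "\<dots> = ennreal (9 / 4 * W) + ennreal (real n) * ennreal (27 * \<sigma>\<^sup>2 * exp (- (T / 2)\<^sup>2 / (4 * \<sigma>\<^sup>2)))"
    by (simp add: ennreal_of_nat_eq_real_of_nat ennreal_mult[symmetric] flip: ennreal_numeral)
  also have "\<dots> = ennreal (9 / 4 * W + real n * (27 * \<sigma>\<^sup>2 * exp (- (T / 2)\<^sup>2 / (4 * \<sigma>\<^sup>2))))"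
    using W by (simp add: ennreal_mult)
  finally show ?thesis
    by (simp add: W_def)
qed

text \<open>On so small a ball no coordinate exceeds \<open>T\<close>, so the minimum in
  \<open>min_square_le_powr\<close> is the squared coordinate itself.\<close>

lemma risk_zero_le:
  assumes "0 < \<tau>" "0 < n" "0 < T" "0 < q" "q \<le> 2" "R \<le> T powr q" and \<theta>: "\<theta> \<in> lq_ball n q R"
  shows "risk \<tau> n (\<lambda>_. \<lambda>i\<in>{1..n}. 0) \<theta> \<le> ennreal (R * T powr (2 - q))"
proof -
  define \<sigma> where "\<sigma> = \<tau> / sqrt (real n)"
  have "\<sigma> > 0"
    using assms by (simp add: \<sigma>_def)
  interpret product_prob_space "\<lambda>_. gauss \<sigma>" "{1..n}"
    using \<open>\<sigma> > 0\<close> by (rule product_prob_space_gauss)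
  have sum_\<theta>: "(\<Sum>i\<in>{1..n}. \<bar>\<theta> i\<bar> powr q) \<le> R"
    using \<theta> by (simp add: lq_ball_def)
  have "(\<Sum>i\<in>{1..n}. (\<theta> i)\<^sup>2) \<le> (\<Sum>i\<in>{1..n}. \<bar>\<theta> i\<bar> powr q * T powr (2 - q))"
  proof (rule sum_mono)
    fix i assume "i \<in> {1..n}"
    then have "\<bar>\<theta> i\<bar> powr q \<le> (\<Sum>i\<in>{1..n}. \<bar>\<theta> i\<bar> powr q)"
      by (intro member_le_sum) auto
    then have "\<bar>\<theta> i\<bar> powr q \<le> T powr q"
      using sum_\<theta> assms by linarith
    then have "\<bar>\<theta> i\<bar> \<le> T"
      using assms by (metis abs_ge_zero less_eq_real_def not_less powr_less_mono2)
    then have "(\<theta> i)\<^sup>2 = min ((\<theta> i)\<^sup>2) (T\<^sup>2)"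
      using assms by (simp add: abs_le_square_iff[symmetric])
    also have "\<dots> \<le> \<bar>\<theta> i\<bar> powr q * T powr (2 - q)"
      using assms by (intro min_square_le_powr) auto
    finally show "(\<theta> i)\<^sup>2 \<le> \<bar>\<theta> i\<bar> powr q * T powr (2 - q)" .
  qed
  also have "\<dots> \<le> R * T powr (2 - q)"
    unfolding sum_distrib_right[symmetric]
    using sum_\<theta> by (intro mult_right_mono) auto
  finally have "ennreal (\<Sum>i\<in>{1..n}. (\<theta> i)\<^sup>2) \<le> ennreal (R * T powr (2 - q))"
    by (rule ennreal_leI)
  moreover have "risk \<tau> n (\<lambda>_. \<lambda>i\<in>{1..n}. 0) \<theta> = ennreal (\<Sum>i\<in>{1..n}. (\<theta> i)\<^sup>2)"
    unfolding risk_eq \<sigma>_def[symmetric]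
    by (simp add: emeasure_space_1 del: One_nat_def)
  ultimately show ?thesis by simp
qed

section \<open>Calibration of the threshold and the spike height, and the choice of
  constants\<close>

section \<open>Minimax bounds at the universal noise level\<close>

text \<open>With \<sigma> = \<tau> / sqrt n this is \<sigma> sqrt (2 log n), the asymptotic size of
  the largest of \<open>n\<close> noise coordinates.\<close>

definition noise_level :: "real \<Rightarrow> nat \<Rightarrow> real" where
  "noise_level \<tau> n = sqrt (2 * \<tau>\<^sup>2 * ln (real n) / real n)"

text \<open>Used in the form 1 \<le> 2 log n, by which the noise level dominates the standard
  deviation of a single coordinate.\<close>

lemma ln_ge_half:
  assumes "2 \<le> n"
  shows "1 / 2 \<le> ln (real n)"
proof -
  have "ln 2 \<le> ln (real n)"
    using assms by (subst ln_le_cancel_iff) auto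
  then show ?thesis
    using ln2_ge_two_thirds by linarith
qed

lemma noise_level_pos:
  assumes "0 < \<tau>" "2 \<le> n"
  shows "0 < noise_level \<tau> n"
  using assms ln_ge_half[of n] by (auto simp: noise_level_def)

lemma noise_level_square:
  assumes "0 < \<tau>" "2 \<le> n"
  shows "(noise_level \<tau> n)\<^sup>2 = 2 * (\<tau> / sqrt (real n))\<^sup>2 * ln (real n)"
  using assms ln_ge_half[of n] by (auto simp: noise_level_def power_divide)

lemma noise_level_powr:
  assumes "0 < \<tau>" "2 \<le> n"
  shows "(2 * \<tau>\<^sup>2 * ln (real n) / real n) powr (p / 2) = noise_level \<tau> n powr p"
proof -
  have "2 * \<tau>\<^sup>2 * ln (real n) / real n = noise_level \<tau> n powr 2"
    using assms noise_level_pos[OF assms] ln_ge_half[of n] by (simp add: noise_level_def)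
  then show ?thesis
    by (simp add: powr_powr)
qed

text \<open>The noise left by thresholding is bounded by a multiple of \<delta>^2, which R
  \<delta>^(2-q) absorbs exactly when \<delta>^q \<le> R; otherwise zero is used. The constant is 63
  = 36 + 27, where 36 = 9/4 * 16 and 16 bounds 4^(2-q).\<close>

lemma minimax_risk_le:
  assumes "0 < \<tau>" "2 \<le> n" "0 < q" "q \<le> 2" "0 < R"
  shows "minimax_risk \<tau> n (lq_ball n q R) \<le> ennreal (63 * R * noise_level \<tau> n powr (2 - q))"
proof -
  define \<delta> where "\<delta> = noise_level \<tau> n"
  define \<sigma> where "\<sigma> = \<tau> / sqrt (real n)"
  have \<delta>: "0 < \<delta>" "\<delta>\<^sup>2 = 2 * \<sigma>\<^sup>2 * ln (real n)"
    using assms noise_level_pos noise_level_square by (auto simp: \<delta>_def \<sigma>_def)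
  have "\<sigma> > 0"
    using assms by (simp add: \<sigma>_def)
  have n: "0 < n"
    using assms by simp
  show ?thesis
  proof (cases "\<delta> powr q \<le> R")
    case True
    \<comment> \<open>The threshold 4 \<delta> is chosen for this exponent: the factor n^(-2)
      outweighs the sum over \<open>n\<close> coordinates.\<close>
    have "exp (- (4 * \<delta> / 2)\<^sup>2 / (4 * \<sigma>\<^sup>2)) = exp (- (2 * ln (real n)))"
      using \<open>\<sigma> > 0\<close> by (simp add: \<delta> power_mult_distrib)
    also have "\<dots> = 1 / (real n)\<^sup>2"
      using n by (simp add: exp_minus exp_double inverse_eq_divide)
    finally have "real n * (27 * \<sigma>\<^sup>2 * exp (- (4 * \<delta> / 2)\<^sup>2 / (4 * \<sigma>\<^sup>2))) = 27 * \<sigma>\<^sup>2 / real n"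
      using n by (simp add: power2_eq_square)
    also have "\<dots> \<le> 27 * \<sigma>\<^sup>2"
      using n by (simp add: divide_le_eq mult_le_cancel_left1)
    also have "\<dots> \<le> 27 * \<delta>\<^sup>2"
      using ln_ge_half[OF \<open>2 \<le> n\<close>] \<open>\<sigma> > 0\<close> unfolding \<delta>(2)
      by (simp add: mult_le_cancel_left1)
    also have "\<delta>\<^sup>2 = \<delta> powr q * \<delta> powr (2 - q)"
      using \<delta>(1) by (simp add: powr_add[symmetric])
    also have "27 * \<dots> \<le> 27 * (R * \<delta> powr (2 - q))"
      using True by (intro mult_left_mono mult_right_mono) auto
    finally have noise: "real n * (27 * \<sigma>\<^sup>2 * exp (- (4 * \<delta> / 2)\<^sup>2 / (4 * \<sigma>\<^sup>2)))
        \<le> 27 * (R * \<delta> powr (2 - q))" .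
    have "(4 :: real) powr (2 - q) \<le> 4 powr 2"
      using assms by (intro powr_mono) auto
    then have "(4 * \<delta>) powr (2 - q) \<le> 16 * \<delta> powr (2 - q)"
      using \<delta>(1) by (simp add: powr_mult)
    then have "R * (4 * \<delta>) powr (2 - q) \<le> R * (16 * \<delta> powr (2 - q))"
      using assms by (intro mult_left_mono) auto
    then have "9 / 4 * (R * (4 * \<delta>) powr (2 - q)) \<le> 36 * (R * \<delta> powr (2 - q))"
      by simp
    with noise have total: "9 / 4 * (R * (4 * \<delta>) powr (2 - q))
        + real n * (27 * \<sigma>\<^sup>2 * exp (- (4 * \<delta> / 2)\<^sup>2 / (4 * \<sigma>\<^sup>2))) \<le> 63 * R * \<delta> powr (2 - q)"
      by linarith
    have "minimax_risk \<tau> n (lq_ball n q R)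
        \<le> (SUP \<theta>\<in>lq_ball n q R. risk \<tau> n (hard_threshold n (4 * \<delta>)) \<theta>)"
      unfolding minimax_risk_def by (rule INF_lower) measurable
    also have "\<dots> \<le> ennreal (63 * R * \<delta> powr (2 - q))"
    proof (rule SUP_least)
      fix \<theta> assume "\<theta> \<in> lq_ball n q R"
      then have "risk \<tau> n (hard_threshold n (4 * \<delta>)) \<theta>
          \<le> ennreal (9 / 4 * (R * (4 * \<delta>) powr (2 - q))
            + real n * (27 * \<sigma>\<^sup>2 * exp (- (4 * \<delta> / 2)\<^sup>2 / (4 * \<sigma>\<^sup>2))))"
        unfolding \<sigma>_def using assms \<delta>(1) n by (intro risk_hard_threshold_le) auto
      also have "\<dots> \<le> ennreal (63 * R * \<delta> powr (2 - q))"
        using total by (rule ennreal_leI)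
      finally show "risk \<tau> n (hard_threshold n (4 * \<delta>)) \<theta> \<le> ennreal (63 * R * \<delta> powr (2 - q))" .
    qed
    finally show ?thesis
      by (simp add: \<delta>_def)
  next
    case False
    have "minimax_risk \<tau> n (lq_ball n q R)
        \<le> (SUP \<theta>\<in>lq_ball n q R. risk \<tau> n (\<lambda>_. \<lambda>i\<in>{1..n}. 0) \<theta>)"
      unfolding minimax_risk_def by (rule INF_lower) measurable
    also have "\<dots> \<le> ennreal (R * \<delta> powr (2 - q))"
      using assms n \<delta>(1) False by (intro SUP_least risk_zero_le) auto
    also have "\<dots> \<le> ennreal (63 * R * \<delta> powr (2 - q))"
      using assms by (intro ennreal_leI mult_right_mono) auto
    finally show ?thesis
      by (simp add: \<delta>_def)
  qed
qed

text \<open>The budget \<open>R\<close> pays for \<open>u\<close> spikes of height \<open>h\<close>.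
  The bound \<delta>^q \<le> R ensures that at least one whole spike fits, and \<open>sparse\<close>
  that the blocks are long enough to hide it. The 1/8 is 1/4 from the spike risk times 1/2 from
  rounding \<open>u\<close> down.\<close>

lemma minimax_risk_ge:
  assumes "0 < \<tau>" "2 \<le> n" "0 < q" "0 < a" "a \<le> 1"
  defines "\<delta> \<equiv> noise_level \<tau> n"
  assumes R: "\<delta> powr q \<le> R"
    and sparse: "8 * real n powr (2 * a\<^sup>2) \<le> real n * (a * \<delta>) powr q / R"
  shows "ennreal (a powr (2 - q) / 8 * R * \<delta> powr (2 - q)) \<le> minimax_risk \<tau> n (lq_ball n q R)"
proof -
  define h where "h = a * \<delta>"
  define u where "u = R / h powr q"
  define k where "k = nat \<lfloor>u\<rfloor>"
  define m where "m = n div k"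
  have \<delta>: "0 < \<delta>" "\<delta>\<^sup>2 = 2 * (\<tau> / sqrt (real n))\<^sup>2 * ln (real n)"
    using assms noise_level_pos noise_level_square by (auto simp: \<delta>_def)
  have h: "0 < h"
    using assms \<delta>(1) by (simp add: h_def)
  have "h powr q \<le> \<delta> powr q"
    using assms h \<delta>(1) by (intro powr_mono2) (auto simp: h_def mult_le_cancel_right1)
  then have u: "1 \<le> u"
    using R h by (simp add: u_def)
  then have k: "1 \<le> k" "real k \<le> u" "u < real k + 1"
    unfolding k_def by linarith+
  have "0 < R"
    using R \<delta>(1) by (smt (verit) powr_gt_zero)
  have X: "1 \<le> real n powr (2 * a\<^sup>2)"
    using assms by (intro ge_one_powr_ge_zero) auto
  have "8 * real n powr (2 * a\<^sup>2) \<le> real n / u"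
    using sparse by (simp add: u_def h_def)
  also have "\<dots> \<le> real n / real k"
    using k by (intro divide_left_mono) auto
  also have "\<dots> < real m + 1"
  proof -
    have "n < (m + 1) * k"
      unfolding m_def using k(1) dividend_less_div_times[of k n] by (simp add: add.commute)
    then have "real n < (real m + 1) * real k"
      using of_nat_less_iff[where 'a = real, of n "(m + 1) * k"] by (simp add: algebra_simps)
    then show ?thesis
      using k(1) by (simp add: pos_divide_less_eq)
  qed
  finally have m: "4 * real n powr (2 * a\<^sup>2) \<le> real m"
    using X by linarith
  have "0 < m"
    using m X by (cases m) auto
  have "h\<^sup>2 / (\<tau> / sqrt (real n))\<^sup>2 = 2 * a\<^sup>2 * ln (real n)"
    using assms(1,2) by (simp add: h_def power_mult_distrib \<delta>(2))
  then have exp_le: "exp (h\<^sup>2 / (\<tau> / sqrt (real n))\<^sup>2) \<le> real m / 4"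
    using m assms by (simp add: powr_def)
  have card_spikes: "real k * h powr q \<le> R"
    using k(2) h by (simp add: u_def pos_le_divide_eq)
  have "a powr (2 - q) / 8 * R * \<delta> powr (2 - q) = u / 2 * (h\<^sup>2 / 4)"
  proof -
    have "h\<^sup>2 = h powr q * h powr (2 - q)"
      using h by (simp add: powr_add[symmetric])
    moreover have "h powr (2 - q) = a powr (2 - q) * \<delta> powr (2 - q)"
      using assms \<delta>(1) by (simp add: h_def powr_mult)
    ultimately show ?thesis
      using h by (simp add: u_def)
  qed
  \<comment> \<open>Here u < k + 1 \<le> 2 k.\<close>
  also have "\<dots> \<le> real k * (h\<^sup>2 / 4)"
    using k by (intro mult_right_mono) auto
  finally have le: "a powr (2 - q) / 8 * R * \<delta> powr (2 - q) \<le> real k * (h\<^sup>2 / 4)" .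
  show ?thesis
    unfolding minimax_risk_def
  proof (rule INF_greatest)
    fix est assume est: "est \<in> borel_vec n \<rightarrow>\<^sub>M borel_vec n"
    have "ennreal (a powr (2 - q) / 8 * R * \<delta> powr (2 - q)) \<le> ennreal (real k * (h\<^sup>2 / 4))"
      using le by (rule ennreal_leI)
    also have "\<dots> \<le> (SUP \<theta>\<in>lq_ball n q R. risk \<tau> n est \<theta>)"
      using assms h \<open>0 < m\<close> card_spikes exp_le est
      by (intro SUP_risk_ge_spikes[where m = m]) (auto simp: m_def mult.commute)
    finally show "ennreal (a powr (2 - q) / 8 * R * \<delta> powr (2 - q))
        \<le> (SUP \<theta>\<in>lq_ball n q R. risk \<tau> n est \<theta>)" .
  qed
qed

text \<open>The lower bound is guarded because the growth condition allows arbitrarily small balls.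
  There the zero estimator has risk at most R^(2/q), and its ratio to R d^(2-q), with d the noise
  level, is (R / d^q)^((2-q)/q), which can tend to 0.\<close>

theorem corollary1:
  fixes q \<kappa> :: real
  assumes "0 < q" and "q \<le> 1" and "0 < \<kappa>"
  shows "\<exists>c' c :: real. 0 < c' \<and> c' \<le> c \<and>
    (\<forall>(\<tau> :: real) (R :: nat \<Rightarrow> real).
       0 < \<tau> \<longrightarrow>
       (\<forall>n. 0 < R n) \<longrightarrow>
       (\<lambda>n. real n / (R n * real n powr (q / 2))) \<in> \<Omega>(\<lambda>n. real n powr \<kappa>) \<longrightarrow>
       (\<forall>\<^sub>F n in sequentially.
          ((2 * \<tau>\<^sup>2 * ln (real n) / real n) powr (q / 2) \<le> R n \<longrightarrow>
            ennreal (c' * R n * (2 * \<tau>\<^sup>2 * ln (real n) / real n) powr (1 - q / 2))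
              \<le> minimax_risk \<tau> n (lq_ball n q (R n))) \<and>
          minimax_risk \<tau> n (lq_ball n q (R n))
            \<le> ennreal (c * R n * (2 * \<tau>\<^sup>2 * ln (real n) / real n) powr (1 - q / 2))))"
proof -
  \<comment> \<open>Half of the growth exponent \<kappa> pays for n^(2 a^2). The other half absorbs,
    for large \<open>n\<close>, the constants that depend on \<tau> and on the growth condition, so
    the constants of the theorem depend on neither.\<close>
  define a where "a = min 1 (sqrt \<kappa> / 2)"
  have a: "0 < a" "a \<le> 1"
    using assms by (auto simp: a_def)
  have "a\<^sup>2 \<le> (sqrt \<kappa> / 2)\<^sup>2"
    using a by (intro power_mono) (auto simp: a_def)
  then have a_sq: "2 * a\<^sup>2 \<le> \<kappa> / 2"
    using assms by (simp add: power_divide)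
  have bounds: "\<forall>\<^sub>F n in sequentially.
      ((2 * \<tau>\<^sup>2 * ln (real n) / real n) powr (q / 2) \<le> R n \<longrightarrow>
        ennreal (a powr (2 - q) / 8 * R n * (2 * \<tau>\<^sup>2 * ln (real n) / real n) powr (1 - q / 2))
          \<le> minimax_risk \<tau> n (lq_ball n q (R n))) \<and>
      minimax_risk \<tau> n (lq_ball n q (R n))
        \<le> ennreal (63 * R n * (2 * \<tau>\<^sup>2 * ln (real n) / real n) powr (1 - q / 2))"
    if \<tau>: "0 < \<tau>" and R: "\<And>n. 0 < R n"
      and growth: "(\<lambda>n. real n / (R n * real n powr (q / 2))) \<in> \<Omega>(\<lambda>n. real n powr \<kappa>)"
    for \<tau> :: real and R :: "nat \<Rightarrow> real"
  proof -
    obtain C where C: "C > 0" and ev: "\<forall>\<^sub>F n in sequentially.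
        norm (real n / (R n * real n powr (q / 2))) \<ge> C * norm (real n powr \<kappa>)"
      using growth by (rule landau_omega.bigE)
    define D where "D = C * (a * \<tau>) powr q"
    have D: "D > 0"
      using C a \<tau> by (simp add: D_def)
    have "filterlim (\<lambda>n. real n powr (\<kappa> / 2)) at_top sequentially"
      using \<open>0 < \<kappa>\<close> by real_asymp
    then have "\<forall>\<^sub>F n in sequentially. 8 / D \<le> real n powr (\<kappa> / 2)"
      by (simp add: filterlim_at_top)
    with ev eventually_ge_at_top[of "2 :: nat"] show ?thesis
    proof eventually_elim
      case (elim n)
      define \<delta> where "\<delta> = noise_level \<tau> n"
      have \<delta>: "0 < \<delta>" "\<delta>\<^sup>2 = 2 * (\<tau> / sqrt (real n))\<^sup>2 * ln (real n)"
        using \<tau> elim noise_level_pos noise_level_square by (auto simp: \<delta>_def)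
      have scale: "(2 * \<tau>\<^sup>2 * ln (real n) / real n) powr (q / 2) = \<delta> powr q"
        "(2 * \<tau>\<^sup>2 * ln (real n) / real n) powr (1 - q / 2) = \<delta> powr (2 - q)"
        using noise_level_powr[OF \<tau> elim(2), of q] noise_level_powr[OF \<tau> elim(2), of "2 - q"]
        by (simp_all add: \<delta>_def diff_divide_distrib)
      have sparse: "8 * real n powr (2 * a\<^sup>2) \<le> real n * (a * \<delta>) powr q / R n"
      proof -
        \<comment> \<open>The noise level is at least \<tau> / sqrt n, which trades the n^(q/2) of
          the growth condition for a power of \<delta>.\<close>
        have "\<tau>\<^sup>2 * 1 \<le> \<tau>\<^sup>2 * (2 * ln (real n))"
          using ln_ge_half[OF elim(2)] by (intro mult_left_mono) auto
        also have "\<dots> = (sqrt (real n) * \<delta>)\<^sup>2"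
          using elim(2) by (simp add: power_mult_distrib \<delta>(2) power_divide)
        finally have "\<tau>\<^sup>2 \<le> (sqrt (real n) * \<delta>)\<^sup>2"
          by simp
        then have "\<tau> \<le> sqrt (real n) * \<delta>"
          by (rule power2_le_imp_le) (use \<delta>(1) in simp)
        then have "(a * \<tau>) powr q \<le> (sqrt (real n) * (a * \<delta>)) powr q"
          using a \<tau> \<open>0 < q\<close> by (intro powr_mono2) (auto simp: mult.left_commute)
        also have "\<dots> = real n powr (q / 2) * (a * \<delta>) powr q"
        proof -
          have "sqrt (real n) powr q = (real n powr (1 / 2)) powr q"
            by (simp add: powr_half_sqrt)
          also have "\<dots> = real n powr (q / 2)"
            unfolding powr_powr by simp
          finally show ?thesis
            using a \<delta>(1) by (simp add: powr_mult)
        qed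
        finally have signal: "(a * \<tau>) powr q \<le> real n powr (q / 2) * (a * \<delta>) powr q" .
        have "8 * real n powr (2 * a\<^sup>2) \<le> 8 * real n powr (\<kappa> / 2)"
          using elim(2) a_sq by (intro mult_left_mono powr_mono) auto
        also have "\<dots> \<le> (D * real n powr (\<kappa> / 2)) * real n powr (\<kappa> / 2)"
          using elim(3) D by (intro mult_right_mono) (auto simp: pos_divide_le_eq mult.commute)
        also have "\<dots> = (C * real n powr \<kappa>) * (a * \<tau>) powr q"
          by (simp add: D_def powr_add[symmetric])
        also have "\<dots> \<le> (real n / (R n * real n powr (q / 2))) * (real n powr (q / 2) * (a * \<delta>) powr q)"
          using elim(1) R[of n] C signal by (intro mult_mono) auto
        also have "\<dots> = real n * (a * \<delta>) powr q / R n"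
          using elim(2) by simp
        finally show ?thesis .
      qed
      show ?case
        unfolding scale
        using minimax_risk_ge[OF \<tau> elim(2) \<open>0 < q\<close> a, of "R n"] sparse
          minimax_risk_le[OF \<tau> elim(2) \<open>0 < q\<close> _ R, of n] \<open>q \<le> 1\<close>
        by (simp add: \<delta>_def)
    qed
  qed
  have "a powr (2 - q) \<le> 1"
    using a assms by (intro powr_le1) auto
  then have "a powr (2 - q) / 8 \<le> 63"
    by simp
  moreover have "0 < a powr (2 - q) / 8"
    using a by simp
  ultimately show ?thesis
    using bounds by blast
qed

end
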